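(* Let $p$ be a prime and $n\ge k\ge 1$ integers such that $s(n,k)$ is a minimum zero case. Let $t$ be a nonnegative integer with $p^{\nu_p(t)}>n$ (where $\nu_p(0)=+\infty$), and put $n'=t+n$, $k'=t+k$. Then $s(n',k')$ is a minimum zero case and (i) $\nu_p(s(n',k'))=\nu_p(s(n,k))$; (ii) $\epsilon_p(s(n',k'))\equiv\epsilon_p(s(n,k)) \pmod p$.
   Context: $s(n,k)$ is the signed Stirling number of the first kind, defined by $x(x-1)\cdots(x-n+1)=\sum_k s(n,k)x^k$. $\nu_p$ is the $p$-adic valuation, $\sigma_p(m)$ the base-$p$ digit sum, and $\epsilon_p(x)=p^{-\nu_p(x)}x$ the unit part of a nonzero rational $x$. $s(n,k)$ is called a minimum zero case if $\nu_p(s(n,k))=(\sigma_p(k-1)-\sigma_p(n-1))/(p-1)$. *)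

theory Defs
  imports
    "HOL-Computational_Algebra.Computational_Algebra"
    "HOL-Combinatorics.Stirling"
begin

definition stirling_signed :: "nat \<Rightarrow> nat \<Rightarrow> int" where
  "stirling_signed n k = poly.coeff (\<Prod>i<n. [:- int i, 1:]) k"

text \<open>The library constant \<^const>\<open>stirling\<close> is the unsigned Stirling number of the first kind.\<close>

lemma stirling_signed_eq: "stirling_signed n k = (-1) ^ (n + k) * int (stirling n k)"
proof (induction n arbitrary: k)
  case 0
  then show ?case by (cases k) (simp_all add: stirling_signed_def)
next
  case (Suc n)
  show ?case
  proof (cases k)
    case 0
    have "poly.coeff (\<Prod>i<Suc n. [:- int i, 1:]) 0 = - int n * stirling_signed n 0"
      by (simp add: stirling_signed_def mult.commute)
    then show ?thesis using Suc[of 0] 0 by (cases n) (simp_all add: stirling_signed_def)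
  next
    case (Suc j)
    have "stirling_signed (Suc n) (Suc j) = - int n * stirling_signed n (Suc j) + stirling_signed n j"
      by (simp add: stirling_signed_def mult.commute[of _ "[:_, 1:]"])
    then show ?thesis using Suc.IH[of "Suc j"] Suc.IH[of j] Suc
      by (simp add: algebra_simps)
  qed
qed

text \<open>Only the positions \<open>i\<close> with \<open>i \<le> m\<close> are summed; for \<open>p \<ge> 2\<close> all digits beyond vanish, as \<open>m < p ^ i\<close>.\<close>

definition digit_sum :: "nat \<Rightarrow> nat \<Rightarrow> nat" where
  "digit_sum p m = (\<Sum>i\<le>m. m div p ^ i mod p)"

text \<open>
  On nonzero rationals this is the \<open>p\<close>-adic valuation. At \<open>0\<close>, where the true value is
  \<open>+\<infinity>\<close>, it is \<open>0\<close> by the convention for \<^const>\<open>multiplicity\<close>, so the case of \<open>0\<close> is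
  treated separately wherever it can occur.
\<close>

definition padic_val :: "nat \<Rightarrow> rat \<Rightarrow> int" where
  "padic_val p x =
     int (multiplicity (int p) (fst (quotient_of x))) - int (multiplicity (int p) (snd (quotient_of x)))"

definition unit_part :: "nat \<Rightarrow> rat \<Rightarrow> rat" where
  "unit_part p x = of_nat p powi (- padic_val p x) * x"

text \<open>Congruence modulo \<open>p\<close> of \<open>p\<close>-integral rationals: the difference has valuation at least \<open>1\<close>.\<close>

definition padic_cong :: "nat \<Rightarrow> rat \<Rightarrow> rat \<Rightarrow> bool" where
  "padic_cong p x y \<longleftrightarrow> x = y \<or> padic_val p (x - y) \<ge> 1"

definition minimum_zero_case :: "nat \<Rightarrow> nat \<Rightarrow> nat \<Rightarrow> bool" where
  "minimum_zero_case p n k \<longleftrightarrow>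
     stirling_signed n k \<noteq> 0 \<and>
     rat_of_int (padic_val p (of_int (stirling_signed n k))) =
       (rat_of_nat (digit_sum p (k - 1)) - rat_of_nat (digit_sum p (n - 1))) / (rat_of_nat p - 1)"

end

theory Submission
  imports Defs
begin

text \<open>
  Write \<open>B = x / (e\<^sup>x - 1)\<close>. Then
  \<open>s(n, k) = k (k + 1) \<cdots> (n - 1) [x\<^sup>d] B\<^sup>n\<close> with \<open>d = n - k\<close>, since both sides satisfy the
  same recurrence by the differential equation \<open>x B' = B - B\<^sup>2 - x B\<close>. By Legendre's formula the
  coefficient of \<open>x\<^sup>j\<close> in \<open>B\<close>, and hence in any power of \<open>B\<close>, has valuation at least
  \<open>- j / (p - 1)\<close>, and \<open>s(n, k)\<close> is a minimum zero case iff the coefficient of \<open>x\<^sup>d\<close> in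
  \<open>B\<^sup>n\<close> attains this bound. Modulo series whose coefficients exceed the bound strictly, Frobenius
  gives \<open>B\<^sup>t \<equiv> 1 + O(x ^ (p ^ a))\<close> whenever \<open>p ^ a\<close> divides \<open>t\<close>. With \<open>p ^ a > n > d\<close>, the
  coefficients of \<open>x\<^sup>d\<close> in \<open>B\<^sup>t\<^sup>+\<^sup>n\<close> and in \<open>B\<^sup>n\<close> therefore agree to leading order,
  while each factor \<open>t + i\<close> with \<open>0 < i < p ^ a\<close> has the valuation of \<open>i\<close> and the same unit part
  modulo \<open>p\<close>.
\<close>

context
  fixes p :: nat
  assumes p: "prime p"
begin

section \<open>The p-adic valuation on the rationals\<close>

lemma prime_int_p: "prime (int p)"
  using p by simp

lemma p_ge_2: "p \<ge> 2"
  using p by (rule prime_ge_2_nat)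

lemma multiplicity_p_mult:
  fixes a b :: int
  assumes "a \<noteq> 0" "b \<noteq> 0"
  shows "multiplicity (int p) (a * b) = multiplicity (int p) a + multiplicity (int p) b"
  using assms prime_int_p by (simp add: prime_elem_multiplicity_mult_distrib prime_imp_prime_elem)

lemma padic_val_divide:
  assumes "a \<noteq> 0" "b \<noteq> 0"
  shows "padic_val p (of_int a / of_int b) =
    int (multiplicity (int p) a) - int (multiplicity (int p) b)"
proof -
  define c d where "c = fst (quotient_of (of_int a / of_int b))"
    and "d = snd (quotient_of (of_int a / of_int b))"
  have q: "quotient_of (of_int a / of_int b) = (c, d)" by (simp add: c_def d_def)
  have d: "d > 0" using q by (rule quotient_of_denom_pos)
  have eq: "(of_int a / of_int b :: rat) = of_int c / of_int d" using q by (rule quotient_of_div)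
  with assms d have "(of_int (a * d) :: rat) = of_int (c * b)" by (simp add: field_simps)
  hence e: "a * d = c * b" by (simp only: of_int_eq_iff)
  have c: "c \<noteq> 0" using e assms d by auto
  have "multiplicity (int p) (a * d) = multiplicity (int p) (c * b)" using e by simp
  hence "multiplicity (int p) a + multiplicity (int p) d = multiplicity (int p) c + multiplicity (int p) b"
    using assms c d by (simp add: multiplicity_p_mult)
  thus ?thesis by (simp add: padic_val_def q)
qed

lemma rat_fraction_cases:
  fixes x :: rat
  obtains a b where "x = of_int a / of_int b" "b \<noteq> 0"
proof -
  obtain a b where q: "quotient_of x = (a, b)" by fastforce
  show thesis using that[OF quotient_of_div[OF q]] quotient_of_denom_pos[OF q] by simp
qed

lemma padic_val_of_int: "a \<noteq> 0 \<Longrightarrow> padic_val p (of_int a) = int (multiplicity (int p) a)"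
  using padic_val_divide[of a 1] by simp

lemma padic_val_of_nat: "a \<noteq> 0 \<Longrightarrow> padic_val p (of_nat a) = int (multiplicity p a)"
proof -
  assume a: "a \<noteq> 0"
  have "\<not> is_unit p" using p_ge_2 by simp
  hence "\<not> p ^ Suc (multiplicity p a) dvd a"
    using a power_dvd_iff_le_multiplicity[of a p "Suc (multiplicity p a)"] by simp
  hence "multiplicity (int p) (int a) = multiplicity p a"
    by (intro multiplicity_eqI) (auto simp: multiplicity_dvd simp flip: of_nat_power of_nat_Suc of_nat_mult)
  thus ?thesis using padic_val_of_int[of "int a"] a by simp
qed

lemma padic_val_mult:
  assumes "x \<noteq> 0" "y \<noteq> 0"
  shows "padic_val p (x * y) = padic_val p x + padic_val p y"
proof -
  obtain a b where x: "x = of_int a / of_int b" "b \<noteq> 0" by (rule rat_fraction_cases)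
  obtain c d where y: "y = of_int c / of_int d" "d \<noteq> 0" by (rule rat_fraction_cases)
  have "x * y = of_int (a * c) / of_int (b * d)" using x y by simp
  moreover have "a \<noteq> 0" "c \<noteq> 0" using x y assms by auto
  ultimately show ?thesis using x y
    by (simp add: padic_val_divide multiplicity_p_mult del: of_int_mult)
qed

lemma padic_val_1: "padic_val p 1 = 0"
  using padic_val_of_int[of 1] by simp

lemma padic_val_p: "padic_val p (of_nat p) = 1"
  using padic_val_of_nat[of p] p p_ge_2 by simp

lemma padic_val_inverse: "x \<noteq> 0 \<Longrightarrow> padic_val p (inverse x) = - padic_val p x"
  using padic_val_mult[of x "inverse x"] by (simp add: padic_val_1)

lemma padic_val_uminus: "padic_val p (- x) = padic_val p x"
proof (cases "x = 0")
  case False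
  have "padic_val p (-1) = 0" using padic_val_of_int[of "-1"] by simp
  thus ?thesis using padic_val_mult[of "-1" x] False by simp
qed simp

lemma padic_val_prod:
  "(\<And>i. i \<in> A \<Longrightarrow> f i \<noteq> 0) \<Longrightarrow> padic_val p (\<Prod>i\<in>A. f i) = (\<Sum>i\<in>A. padic_val p (f i))"
  by (induction A rule: infinite_finite_induct) (auto simp: padic_val_1 padic_val_mult)

lemma padic_val_p_powi: "padic_val p (of_nat p powi e) = e"
proof -
  have p0: "(of_nat p :: rat) \<noteq> 0" using p_ge_2 by simp
  have nat: "padic_val p (of_nat p ^ m) = int m" for m
    using p0 by (induction m) (auto simp: padic_val_1 padic_val_mult padic_val_p)
  show ?thesis
    using p0 by (cases "e \<ge> 0") (auto simp: power_int_def power_inverse padic_val_inverse nat)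
qed

text \<open>The exponent is an integer so that bounds obtained by subtracting valuations fit; for
  negative \<open>e\<close> both sides hold, as \<open>nat e\<close> is 0.\<close>

lemma multiplicity_ge_iff:
  fixes a :: int
  assumes "a \<noteq> 0"
  shows "e \<le> int (multiplicity (int p) a) \<longleftrightarrow> int p ^ nat e dvd a"
proof -
  have "\<not> is_unit (int p)" using p_ge_2 by simp
  hence "int p ^ nat e dvd a \<longleftrightarrow> nat e \<le> multiplicity (int p) a"
    using assms by (intro power_dvd_iff_le_multiplicity) auto
  thus ?thesis by (simp add: nat_le_iff)
qed

lemma padic_val_add:
  assumes "x \<noteq> 0" "y \<noteq> 0" "x + y \<noteq> 0" "e \<le> padic_val p x" "e \<le> padic_val p y"
  shows "e \<le> padic_val p (x + y)"
proof -
  obtain a b where x: "x = of_int a / of_int b" "b \<noteq> 0" by (rule rat_fraction_cases)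
  obtain c d where y: "y = of_int c / of_int d" "d \<noteq> 0" by (rule rat_fraction_cases)
  have ac: "a \<noteq> 0" "c \<noteq> 0" using x y assms by auto
  have xy: "x + y = of_int (a * d + c * b) / of_int (b * d)" using x y by (simp add: field_simps)
  have n0: "a * d + c * b \<noteq> 0" 
  proof
    assume "a * d + c * b = 0"
    with xy assms(3) show False by (simp only: of_int_0 div_0)
  qed
  \<comment> \<open>Over the common denominator \<open>b * d\<close>, the bound \<open>e\<close> on
    each summand becomes divisibility of its numerator by the same power of
    \<open>p\<close>.\<close>
  define m where "m = e + int (multiplicity (int p) (b * d))"
  have "m \<le> int (multiplicity (int p) (a * d))" "m \<le> int (multiplicity (int p) (c * b))"
    using assms(4,5) x y ac by (auto simp: m_def padic_val_divide multiplicity_p_mult)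
  hence "int p ^ nat m dvd a * d + c * b" using ac x y by (auto simp: multiplicity_ge_iff)
  hence "m \<le> int (multiplicity (int p) (a * d + c * b))" using n0 by (simp add: multiplicity_ge_iff)
  moreover have "padic_val p (x + y) =
      int (multiplicity (int p) (a * d + c * b)) - int (multiplicity (int p) (b * d))"
    unfolding xy using n0 x y by (intro padic_val_divide) auto
  ultimately show ?thesis by (simp add: m_def)
qed

section \<open>Scaled valuation bounds, unit parts and congruence modulo p\<close>

text \<open>The valuation is scaled by \<open>p - 1\<close> so that the bound \<open>- j / (p - 1)\<close> becomes integral.\<close>

definition val_ge :: "int \<Rightarrow> rat \<Rightarrow> bool" where
  "val_ge c x \<longleftrightarrow> x = 0 \<or> c \<le> (int p - 1) * padic_val p x"

lemma val_ge_0 [simp]: "val_ge c 0"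
  by (simp add: val_ge_def)

lemma val_ge_mono: "val_ge c x \<Longrightarrow> d \<le> c \<Longrightarrow> val_ge d x"
  by (auto simp: val_ge_def)

lemma val_ge_mult: "val_ge c x \<Longrightarrow> val_ge d y \<Longrightarrow> val_ge (c + d) (x * y)"
  by (cases "x = 0 \<or> y = 0") (auto simp: val_ge_def padic_val_mult distrib_left)

lemma val_ge_add:
  assumes "val_ge c x" "val_ge c y"
  shows "val_ge c (x + y)"
proof (cases "x = 0 \<or> y = 0 \<or> x + y = 0")
  case False
  hence "min (padic_val p x) (padic_val p y) \<le> padic_val p (x + y)"
    by (intro padic_val_add) auto
  hence "(int p - 1) * min (padic_val p x) (padic_val p y) \<le> (int p - 1) * padic_val p (x + y)"
    using p_ge_2 by (intro mult_left_mono) auto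
  with assms False show ?thesis by (auto simp: val_ge_def min_def split: if_splits)
qed (use assms in \<open>auto simp: val_ge_def\<close>)

lemma val_ge_uminus: "val_ge c x \<Longrightarrow> val_ge c (- x)"
  by (auto simp: val_ge_def padic_val_uminus)

lemma val_ge_diff: "val_ge c x \<Longrightarrow> val_ge c y \<Longrightarrow> val_ge c (x - y)"
  using val_ge_add[of c x "- y"] val_ge_uminus[of c y] by simp

lemma val_ge_sum: "(\<And>i. i \<in> A \<Longrightarrow> val_ge c (f i)) \<Longrightarrow> val_ge c (\<Sum>i\<in>A. f i)"
  by (induction A rule: infinite_finite_induct) (auto intro: val_ge_add)

lemma val_ge_of_nat: "val_ge 0 (of_nat a)"
  using p_ge_2 by (cases "a = 0") (auto simp: val_ge_def padic_val_of_nat)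

lemma val_ge_p: "val_ge (int p - 1) (of_nat p)"
  by (simp add: val_ge_def padic_val_p)

text \<open>Scaled valuations are multiples of \<open>p - 1\<close>, so a positive one already means
  valuation at least 1.\<close>

lemma padic_cong_iff: "padic_cong p x y \<longleftrightarrow> val_ge 1 (x - y)"
proof -
  have "1 \<le> (int p - 1) * v \<longleftrightarrow> 1 \<le> v" for v
    using p_ge_2 zero_less_mult_iff[of "int p - 1" v] by (auto simp: int_one_le_iff_zero_less)
  thus ?thesis by (auto simp: padic_cong_def val_ge_def)
qed

text \<open>A perturbation of strictly larger valuation leaves the leading term intact: if
  \<open>y\<close> had larger valuation than \<open>x\<close>, then so would
  \<open>x = y - (y - x)\<close>.\<close>

lemma padic_val_eq_of_diff:
  assumes "x \<noteq> 0" "val_ge ((int p - 1) * padic_val p x + 1) (y - x)"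
  shows "y \<noteq> 0" "padic_val p y = padic_val p x"
proof -
  let ?r = "int p - 1"
  have r: "?r > 0" using p_ge_2 by simp
  show y: "y \<noteq> 0"
    using assms by (auto simp: val_ge_def padic_val_uminus)
  have "val_ge (?r * padic_val p x) y"
    using val_ge_add[of "?r * padic_val p x" x "y - x"] val_ge_mono[OF assms(2)]
    by (simp add: val_ge_def)
  hence 1: "padic_val p x \<le> padic_val p y" using y r by (simp add: val_ge_def)
  have 2: "\<not> padic_val p x < padic_val p y"
  proof
    assume "padic_val p x < padic_val p y"
    hence "?r * padic_val p x < ?r * padic_val p y" using r by simp
    hence "val_ge (?r * padic_val p x + 1) y" by (simp add: val_ge_def)
    from val_ge_diff[OF this assms(2)] show False using assms(1) by (simp add: val_ge_def)
  qed
  from 1 2 show "padic_val p y = padic_val p x" by simp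
qed

lemma unit_part_mult: "x \<noteq> 0 \<Longrightarrow> y \<noteq> 0 \<Longrightarrow> unit_part p (x * y) = unit_part p x * unit_part p y"
  using p_ge_2
  by (simp add: unit_part_def padic_val_mult power_int_diff power_int_minus field_simps)

lemma val_ge_unit_part: "val_ge 0 (unit_part p x)"
  using p_ge_2
  by (cases "x = 0") (auto simp: val_ge_def unit_part_def padic_val_mult padic_val_p_powi)

lemma padic_cong_mult:
  assumes "val_ge 0 x'" "val_ge 0 y" "padic_cong p x' x" "padic_cong p y' y"
  shows "padic_cong p (x' * y') (x * y)"
proof -
  \<comment> \<open>The split is x'y' - xy = x'(y' - y) + (x' - x)y, which calls for integrality of
    \<open>x'\<close> and \<open>y\<close>.\<close>
  have "val_ge (0 + 1) (x' * (y' - y))" "val_ge (1 + 0) ((x' - x) * y)"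
    using assms by (auto simp only: padic_cong_iff intro!: val_ge_mult)
  from val_ge_add[OF this[simplified]] show ?thesis
    by (simp add: padic_cong_iff algebra_simps)
qed

lemma unit_part_prod_cong:
  assumes "\<And>i. i \<in> A \<Longrightarrow> f i \<noteq> 0" "\<And>i. i \<in> A \<Longrightarrow> g i \<noteq> 0"
    and "\<And>i. i \<in> A \<Longrightarrow> padic_cong p (unit_part p (f i)) (unit_part p (g i))"
  shows "padic_cong p (unit_part p (\<Prod>i\<in>A. f i)) (unit_part p (\<Prod>i\<in>A. g i))"
  using assms
  by (induction A rule: infinite_finite_induct)
     (auto simp: unit_part_mult padic_cong_def[of _ x x for x] intro!: padic_cong_mult val_ge_unit_part)

text \<open>Both numbers have the same valuation, so one power of \<open>p\<close> normalizes both
  and turns the excess of the difference into a congruence.\<close>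

lemma padic_cong_of_diff:
  assumes "x \<noteq> 0" "val_ge ((int p - 1) * padic_val p x + 1) (y - x)"
  shows "padic_cong p (unit_part p y) (unit_part p x)"
proof -
  have "val_ge ((int p - 1) * (- padic_val p x)) (of_nat p powi (- padic_val p x))"
    by (simp add: val_ge_def padic_val_p_powi)
  from val_ge_mult[OF this assms(2)] show ?thesis
    using padic_val_eq_of_diff[OF assms]
    by (simp add: padic_cong_iff unit_part_def algebra_simps)
qed

section \<open>Digit sums and Legendre's formula\<close>

lemma digit_sum_bound:
  assumes "m \<le> M"
  shows "digit_sum p m = (\<Sum>i\<le>M. m div p ^ i mod p)"
  unfolding digit_sum_def
proof (rule sum.mono_neutral_left)
  show "\<forall>i\<in>{..M} - {..m}. m div p ^ i mod p = 0"
  proof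
    fix i assume "i \<in> {..M} - {..m}"
    hence "m < p ^ i" using power_gt_expt[of p i] p_ge_2 by auto
    thus "m div p ^ i mod p = 0" by simp
  qed
qed (use assms in auto)

lemma digit_sum_rec: "digit_sum p m = m mod p + digit_sum p (m div p)"
proof -
  have "digit_sum p m = (\<Sum>i\<le>Suc m. m div p ^ i mod p)" by (rule digit_sum_bound) simp
  also have "\<dots> = m mod p + (\<Sum>i\<le>m. m div p ^ Suc i mod p)"
    by (subst sum.atMost_Suc_shift) simp
  also have "(\<Sum>i\<le>m. m div p ^ Suc i mod p) = (\<Sum>i\<le>m. m div p div p ^ i mod p)"
    by (simp add: div_mult2_eq)
  also have "\<dots> = digit_sum p (m div p)" by (rule digit_sum_bound[symmetric]) simp
  finally show ?thesis .
qed

text \<open>Adding 1 turns each trailing digit \<open>p - 1\<close> into 0, one for every factor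
  \<open>p\<close> of \<open>Suc m\<close>, and raises the next digit by 1. The induction strips the
  last digit.\<close>

lemma digit_sum_Suc: "digit_sum p (Suc m) + (p - 1) * multiplicity p (Suc m) = digit_sum p m + 1"
proof (induction m rule: less_induct)
  case (less m)
  show ?case
  proof (cases "p dvd Suc m")
    case False
    hence "Suc m mod p = Suc (m mod p)" "Suc m div p = m div p"
      by (auto simp: mod_Suc div_Suc dvd_eq_mod_eq_0 split: if_splits)
    thus ?thesis using False digit_sum_rec[of m] digit_sum_rec[of "Suc m"]
      by (simp add: not_dvd_imp_multiplicity_0)
  next
    case True
    then obtain q' where q': "Suc m = p * q'" by auto
    then obtain q where q: "q' = Suc q" by (cases q') auto
    have m: "m = p * q + (p - 1)" using q' q p_ge_2 by (simp add: algebra_simps)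
    have "q \<le> p * q" using p_ge_2 by simp
    hence "q < m" using m p_ge_2 by linarith
    note IH = less.IH[OF this]
    have md: "m div p = q" "m mod p = p - 1"
      unfolding m using p_ge_2 by (subst div_mult_self4 mod_mult_self4; simp)+
    have Sd: "Suc m div p = Suc q" "Suc m mod p = 0" unfolding q' q using p_ge_2 by auto
    have "multiplicity p (Suc m) = Suc (multiplicity p (Suc q))"
      unfolding q' q using p_ge_2 by (intro multiplicity_times_same) auto
    hence "(p - 1) * multiplicity p (Suc m) = (p - 1) + (p - 1) * multiplicity p (Suc q)" by simp
    moreover have "digit_sum p m = (p - 1) + digit_sum p q" "digit_sum p (Suc m) = digit_sum p (Suc q)"
      using digit_sum_rec[of m] digit_sum_rec[of "Suc m"] md Sd by simp_all
    ultimately show ?thesis using IH by linarith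
  qed
qed

text \<open>Legendre's formula, obtained by telescoping \<open>digit_sum_Suc\<close> over the
  factors of the factorial.\<close>

lemma padic_val_fact:
  "(int p - 1) * padic_val p (fact m) = int m - int (digit_sum p m)"
proof (induction m)
  case 0
  then show ?case by (simp add: padic_val_1 digit_sum_def)
next
  case (Suc m)
  have "int (digit_sum p (Suc m)) + (int p - 1) * int (multiplicity p (Suc m)) = int (digit_sum p m) + 1"
    using arg_cong[OF digit_sum_Suc[of m], of int] p_ge_2 by (simp add: of_nat_diff)
  moreover have "padic_val p (fact (Suc m)) = int (multiplicity p (Suc m)) + padic_val p (fact m)"
    using padic_val_mult[of "of_nat (Suc m)" "fact m"] padic_val_of_nat[of "Suc m"] by simp
  ultimately show ?case using Suc by (simp add: algebra_simps del: fact_Suc)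
qed

lemma digit_sum_pos: "m > 0 \<Longrightarrow> digit_sum p m > 0"
proof (induction m rule: less_induct)
  case (less m)
  show ?case
  proof (cases "m mod p = 0")
    case True
    hence "m div p > 0" using less.prems p_ge_2 by (auto elim: dvdE)
    moreover have "m div p < m" using less.prems p_ge_2 by simp
    ultimately show ?thesis using less.IH digit_sum_rec[of m] by simp
  qed (use digit_sum_rec[of m] in simp)
qed

text \<open>By Legendre the scaled valuation of (j+1)! is j + 1 minus a digit sum that is at least
  1, hence at most j.\<close>

lemma val_ge_inverse_fact: "val_ge (- int j) (1 / fact (Suc j))"
  using padic_val_fact[of "Suc j"] digit_sum_pos[of "Suc j"]
    padic_val_inverse[of "fact (Suc j)"]
  by (simp add: val_ge_def divide_inverse del: fact_Suc)

section \<open>Power series with bounded coefficient valuations\<close>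

text \<open>
  Substituting \<open>x = \<pi> y\<close> with \<open>v(\<pi>) = 1 / (p - 1)\<close>, the elements of \<open>val_ideal 0\<close> are the series in
  \<open>y\<close> with integral coefficients, and \<open>val_ideal N\<close> consists of those that are \<open>O(y ^ N)\<close> modulo \<open>\<pi>\<close>.
\<close>

definition val_ideal :: "nat \<Rightarrow> rat fps set" where
  "val_ideal N = {f. \<forall>j. val_ge ((if j < N then 1 else 0) - int j) (f $ j)}"

lemma val_idealD: "f \<in> val_ideal N \<Longrightarrow> val_ge ((if j < N then 1 else 0) - int j) (f $ j)"
  by (simp add: val_ideal_def)

lemma val_ideal_mono: "f \<in> val_ideal N \<Longrightarrow> M \<le> N \<Longrightarrow> f \<in> val_ideal M"
  by (auto simp: val_ideal_def intro!: val_ge_mono[OF val_idealD[of f N]])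

lemma val_ideal_0 [simp]: "0 \<in> val_ideal N"
  by (simp add: val_ideal_def)

lemma val_ideal_1: "1 \<in> val_ideal 0"
  by (simp add: val_ideal_def val_ge_def padic_val_1)

lemma val_ideal_add: "f \<in> val_ideal N \<Longrightarrow> g \<in> val_ideal N \<Longrightarrow> f + g \<in> val_ideal N"
  by (simp add: val_ideal_def val_ge_add)

lemma val_ideal_sum: "(\<And>i. i \<in> A \<Longrightarrow> f i \<in> val_ideal N) \<Longrightarrow> (\<Sum>i\<in>A. f i) \<in> val_ideal N"
  by (induction A rule: infinite_finite_induct) (auto intro: val_ideal_add)

lemma val_ideal_mult:
  assumes "f \<in> val_ideal N" "g \<in> val_ideal M"
  shows "f * g \<in> val_ideal (N + M)"
  unfolding val_ideal_def mem_Collect_eq fps_mult_nth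
proof (intro allI val_ge_sum)
  fix j i :: nat
  assume "i \<in> {0..j}"
  \<comment> \<open>If \<open>j < N + M\<close>, then \<open>i < N\<close> or
    \<open>j - i < M\<close>, so at least one factor supplies the extra 1.\<close>
  thus "val_ge ((if j < N + M then 1 else 0) - int j) (f $ i * g $ (j - i))"
    by (intro val_ge_mono[OF val_ge_mult[OF val_idealD[OF assms(1)] val_idealD[OF assms(2)]]]) auto
qed

lemma val_ideal_power: "f \<in> val_ideal N \<Longrightarrow> f ^ m \<in> val_ideal (m * N)"
  by (induction m) (auto simp: val_ideal_1 intro: val_ideal_mult)

text \<open>The factor \<open>p\<close> has scaled valuation \<open>p - 1 \<ge> 1\<close>, so every
  coefficient exceeds the bound strictly and \<open>N\<close> can be arbitrary.\<close>

lemma val_ideal_of_nat_mult: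
  assumes "p dvd m" "f \<in> val_ideal 0"
  shows "of_nat m * f \<in> val_ideal N"
proof -
  obtain q where q: "m = p * q" using assms by auto
  have "val_ge (1 - int j) (of_nat m * f $ j)" for j
    using val_ge_mult[OF val_ge_mult[OF val_ge_p val_ge_of_nat[of q]] val_idealD[OF assms(2), of j]] p_ge_2
    unfolding q by (auto elim: val_ge_mono)
  hence "val_ge ((if j < N then 1 else 0) - int j) (of_nat m * f $ j)" for j
    by (rule val_ge_mono) auto
  thus ?thesis by (simp add: val_ideal_def fps_of_nat[symmetric])
qed

text \<open>In the expansion of \<open>(g + 1) ^ p\<close> with \<open>g = f - 1\<close>, the inner
  binomial coefficients are divisible by \<open>p\<close>; what remains besides 1 is
  \<open>g ^ p\<close>.\<close>

lemma val_ideal_frobenius: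
  assumes "f - 1 \<in> val_ideal N"
  shows "f ^ p - 1 \<in> val_ideal (p * N)"
proof -
  define g where "g = f - 1"
  have g: "g ^ i \<in> val_ideal 0" for i
    using val_ideal_power[OF assms, of i] by (auto simp: g_def intro: val_ideal_mono)
  have split: "{..p} = insert 0 (insert p {1..<p})" using p_ge_2 by auto
  have "f ^ p = (g + 1) ^ p" by (simp add: g_def)
  also have "\<dots> = (\<Sum>i\<le>p. of_nat (p choose i) * g ^ i)" by (simp add: binomial_ring)
  also have "\<dots> = 1 + (g ^ p + (\<Sum>i=1..<p. of_nat (p choose i) * g ^ i))"
    unfolding split using p_ge_2 by simp
  finally have "f ^ p - 1 = g ^ p + (\<Sum>i=1..<p. of_nat (p choose i) * g ^ i)" by simp
  moreover have "g ^ p \<in> val_ideal (p * N)"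
    using val_ideal_power[OF assms] by (simp add: g_def)
  moreover have "(\<Sum>i=1..<p. of_nat (p choose i) * g ^ i) \<in> val_ideal (p * N)"
    using p by (intro val_ideal_sum val_ideal_of_nat_mult g dvd_choose_prime) auto
  ultimately show ?thesis by (simp add: val_ideal_add)
qed

lemma val_ideal_power_p_power:
  assumes "f - 1 \<in> val_ideal N"
  shows "f ^ (p ^ a) - 1 \<in> val_ideal (p ^ a * N)"
proof (induction a)
  case (Suc a)
  from val_ideal_frobenius[OF this] show ?case by (simp add: power_mult[symmetric] mult_ac)
qed (use assms in simp)

text \<open>This absorbs the cofactor \<open>u\<close> when an exponent \<open>p ^ a * u\<close> is
  treated as a \<open>p ^ a\<close>-th power raised to \<open>u\<close>.\<close>

lemma val_ideal_power_diff_one: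
  assumes "f - 1 \<in> val_ideal N"
  shows "f ^ m - 1 \<in> val_ideal N"
proof (induction m)
  case (Suc m)
  have f: "f \<in> val_ideal 0"
    using val_ideal_add[OF val_ideal_mono[OF assms le0] val_ideal_1] by simp
  have "f ^ Suc m - 1 = f * (f ^ m - 1) + (f - 1)" by (simp add: algebra_simps)
  moreover have "f * (f ^ m - 1) \<in> val_ideal N" using val_ideal_mult[OF f Suc] by simp
  ultimately show ?case using assms by (simp only: val_ideal_add)
qed simp

text \<open>With constant coefficient 1, comparing coefficients in \<open>f * inverse f = 1\<close>
  gives each coefficient of the inverse from earlier ones without division, and the bounds for
  \<open>i\<close> and \<open>j - i\<close> add up to that for \<open>j\<close>.\<close>

lemma val_ideal_inverse:
  assumes "f \<in> val_ideal 0" "f $ 0 = 1"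
  shows "inverse f \<in> val_ideal 0"
proof -
  have "val_ge (- int j) (inverse f $ j)" for j
  proof (induction j rule: less_induct)
    case (less j)
    show ?case
    proof (cases "j = 0")
      case True
      thus ?thesis using assms(2) by (simp add: val_ge_def padic_val_1)
    next
      case False
      have "(f * inverse f) $ j = 0" using assms(2) False by (simp add: inverse_mult_eq_1')
      moreover have "(f * inverse f) $ j = inverse f $ j + (\<Sum>i=1..j. f $ i * inverse f $ (j - i))"
        using assms(2) by (simp add: fps_mult_nth sum.atLeast_Suc_atMost)
      ultimately have "inverse f $ j = - (\<Sum>i=1..j. f $ i * inverse f $ (j - i))" by simp
      moreover have "val_ge (- int j) (f $ i * inverse f $ (j - i))" if "i \<in> {1..j}" for i
        using val_ge_mult[OF val_idealD[OF assms(1), of i] less.IH[of "j - i"]] that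
        by (auto elim: val_ge_mono)
      ultimately show ?thesis by (simp only: val_ge_uminus val_ge_sum)
    qed
  qed
  thus ?thesis by (simp add: val_ideal_def)
qed

end

section \<open>Stirling numbers as coefficients of powers of x/(e^x - 1)\<close>

text \<open>Inverting (e^x - 1)/x, whose constant coefficient is 1, avoids a quotient of two series
  that vanish at 0.\<close>

definition bernoulli_gf :: "rat fps" where
  "bernoulli_gf = inverse (Abs_fps (\<lambda>i. 1 / fact (Suc i)))"

lemma bernoulli_gf_0 [simp]: "bernoulli_gf $ 0 = 1"
  by (simp add: bernoulli_gf_def)

lemma bernoulli_gf_deriv:
  "fps_X * fps_deriv bernoulli_gf = bernoulli_gf - bernoulli_gf\<^sup>2 - fps_X * bernoulli_gf"
proof -
  define E :: "rat fps" where "E = Abs_fps (\<lambda>i. 1 / fact (Suc i))"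
  let ?B = "bernoulli_gf"
  have B: "?B = inverse E" by (simp add: bernoulli_gf_def E_def)
  have E0: "E $ 0 = 1" by (simp add: E_def)
  have EB: "E * ?B = 1" unfolding B by (simp add: E0 inverse_mult_eq_1')
  \<comment> \<open>Differentiating xE = e^x - 1 gives E + xE' = e^x = xE + 1.\<close>
  have ode: "fps_X * fps_deriv E = fps_X * E + 1 - E"
  proof (rule fps_ext)
    fix i show "(fps_X * fps_deriv E) $ i = (fps_X * E + 1 - E) $ i"
    proof (cases i)
      case 0
      thus ?thesis by (simp add: E_def)
    next
      case (Suc j)
      have "1 / (fact (Suc j) :: rat) = of_nat (Suc (Suc j)) / fact (Suc (Suc j))"
        by (subst fact_Suc[of "Suc j"]) (simp del: fact_Suc of_nat_Suc)
      hence "1 / (fact (Suc j) :: rat) = of_nat (Suc j) / fact (Suc (Suc j)) + 1 / fact (Suc (Suc j))"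
        by (simp only: of_nat_Suc[of "Suc j"] add_divide_distrib add.commute)
      moreover have "(fps_X * fps_deriv E) $ i = of_nat (Suc j) / fact (Suc (Suc j))"
        by (simp add: Suc E_def del: fact_Suc of_nat_Suc)
      moreover have "(fps_X * E + 1 - E) $ i = 1 / fact (Suc j) - 1 / fact (Suc (Suc j))"
        by (simp add: Suc E_def del: fact_Suc of_nat_Suc)
      ultimately show ?thesis by simp
    qed
  qed
  have "fps_deriv ?B = - fps_deriv E * ?B\<^sup>2"
    unfolding B by (subst fps_inverse_deriv) (simp_all add: E0)
  hence "fps_X * fps_deriv ?B = - (fps_X * fps_deriv E) * ?B\<^sup>2" by (simp add: algebra_simps)
  \<comment> \<open>The products \<open>E * ?B\<close> are kept together so that \<open>EB\<close>
    can replace them by 1.\<close>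
  also have "\<dots> = - (fps_X * ?B * (E * ?B) + ?B\<^sup>2 - ?B * (E * ?B))"
    unfolding ode by (simp add: algebra_simps power2_eq_square)
  finally show ?thesis unfolding EB by simp
qed

text \<open>Multiplying the differential equation for B by n B^(n-1) gives x(B^n)' = n(B^n - B^(n+1)
  - xB^n); the claim compares coefficients of x^d.\<close>

lemma bernoulli_gf_power_rec:
  assumes "n > 0"
  shows "of_nat n * (bernoulli_gf ^ Suc n $ d) =
    (of_nat n - of_nat d) * (bernoulli_gf ^ n $ d) - (if d = 0 then 0 else of_nat n * (bernoulli_gf ^ n $ (d - 1)))"
proof -
  let ?B = bernoulli_gf
  obtain m where n: "n = Suc m" using assms by (cases n) auto
  have "fps_X * fps_deriv (?B ^ n) = fps_const (of_nat n) * (?B ^ m * (fps_X * fps_deriv ?B))"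
    unfolding n by (subst fps_deriv_power) (simp add: mult_ac del: of_nat_Suc power_Suc)
  also have "?B ^ m * (fps_X * fps_deriv ?B) = ?B ^ n - ?B ^ Suc n - fps_X * ?B ^ n"
    unfolding bernoulli_gf_deriv n by (simp add: algebra_simps power2_eq_square)
  finally have "(fps_X * fps_deriv (?B ^ n)) $ d =
      of_nat n * (?B ^ n $ d - ?B ^ Suc n $ d - (fps_X * ?B ^ n) $ d)"
    by (simp only: fps_mult_left_const_nth fps_sub_nth)
  thus ?thesis by (cases d) (auto simp: right_diff_distrib left_diff_distrib simp del: power_Suc)
qed

lemma stirling_signed_Suc:
  "stirling_signed (Suc n) k =
    (if k = 0 then 0 else stirling_signed n (k - 1)) - int n * stirling_signed n k"
  by (cases k) (simp_all add: stirling_signed_def mult.commute[of _ "[:_, 1:]"])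

text \<open>Induction on \<open>n\<close>: the triangular recurrence of the Stirling numbers matches
  \<open>bernoulli_gf_power_rec\<close>. Shifted indices and factorials on both sides avoid
  truncated subtraction and quotients.\<close>

lemma stirling_signed_bernoulli:
  assumes "k \<le> n"
  shows "of_int (stirling_signed (Suc n) (Suc k)) * fact k =
    fact n * (bernoulli_gf ^ Suc n $ (n - k))"
  using assms
proof (induction n arbitrary: k)
  case 0
  thus ?case by (simp add: stirling_signed_def)
next
  case (Suc n)
  let ?B = bernoulli_gf
  let ?s = "\<lambda>n k. of_int (stirling_signed n k) :: rat"
  have rec: "?s (Suc (Suc n)) (Suc k) = ?s (Suc n) k - of_nat (Suc n) * ?s (Suc n) (Suc k)"
    by (subst stirling_signed_Suc) simp
  have 1: "?s (Suc n) k * fact k = of_nat k * fact n * (?B ^ Suc n $ (Suc n - k))"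
  proof (cases k)
    case 0
    thus ?thesis by (simp add: stirling_signed_eq)
  next
    case (Suc j)
    thus ?thesis using Suc.IH[of j] Suc.prems by simp
  qed
  \<comment> \<open>The zero branch is \<open>k = Suc n\<close>, outside the range of the induction
    hypothesis; there the Stirling number vanishes.\<close>
  have 2: "?s (Suc n) (Suc k) * fact k =
      (if Suc n - k = 0 then 0 else fact n * (?B ^ Suc n $ (Suc n - k - 1)))"
    using Suc.IH[of k] Suc.prems by (auto simp: stirling_signed_eq)
  have k: "of_nat (Suc n) - of_nat (Suc n - k) = (of_nat k :: rat)"
    using Suc.prems by (simp add: of_nat_diff del: of_nat_Suc)
  have "?s (Suc (Suc n)) (Suc k) * fact k =
      ?s (Suc n) k * fact k - of_nat (Suc n) * (?s (Suc n) (Suc k) * fact k)"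
    unfolding rec by (simp add: algebra_simps)
  also have "\<dots> = fact n * (of_nat k * (?B ^ Suc n $ (Suc n - k))
      - (if Suc n - k = 0 then 0 else of_nat (Suc n) * (?B ^ Suc n $ (Suc n - k - 1))))"
    unfolding 1 2 by (simp add: algebra_simps)
  also have "\<dots> = fact n * (of_nat (Suc n) * (?B ^ Suc (Suc n) $ (Suc n - k)))"
    by (subst bernoulli_gf_power_rec[of "Suc n"]) (simp_all add: k del: of_nat_Suc power_Suc)
  finally show ?case by (simp add: algebra_simps)
qed

lemma fact_eq_fact_mult_prod:
  assumes "1 \<le> k" "k \<le> n"
  shows "(fact (n - 1) :: 'a :: {comm_semiring_1, semiring_char_0}) =
    fact (k - 1) * (\<Prod>i=k..<n. of_nat i)"
  using assms(2)
proof (induction n rule: dec_induct)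
  case (step n)
  have "(fact (Suc n - 1) :: 'a) = of_nat n * fact (n - 1)"
    using assms(1) step.hyps by (simp add: fact_reduce)
  with step show ?case by (simp add: mult_ac)
qed simp

text \<open>Writing the factorial quotient as a product lets the shift by \<open>t\<close> be
  handled factor by factor.\<close>

lemma stirling_signed_eq_prod:
  assumes "1 \<le> k" "k \<le> n"
  shows "of_int (stirling_signed n k) =
    (\<Prod>i=k..<n. of_nat i) * (bernoulli_gf ^ n $ (n - k))"
proof -
  have "of_int (stirling_signed n k) * fact (k - 1) = fact (n - 1) * (bernoulli_gf ^ n $ (n - k))"
    using stirling_signed_bernoulli[of "k - 1" "n - 1"] assms by (simp del: power_Suc)
  thus ?thesis unfolding fact_eq_fact_mult_prod[OF assms] by simp
qed

section \<open>Effect of the shift by t\<close>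

lemma bernoulli_gf_val_ideal:
  assumes "prime p"
  shows "bernoulli_gf \<in> val_ideal p 0" "bernoulli_gf - 1 \<in> val_ideal p 1"
proof -
  show *: "bernoulli_gf \<in> val_ideal p 0"
    unfolding bernoulli_gf_def using val_ge_inverse_fact[OF assms]
    by (intro val_ideal_inverse[OF assms]) (simp_all add: val_ideal_def[OF assms] del: fact_Suc)
  \<comment> \<open>The strict bound is required only of the constant coefficient, which is 0
    here.\<close>
  show "bernoulli_gf - 1 \<in> val_ideal p 1"
    using * by (auto simp: val_ideal_def[OF assms] val_ge_0[OF assms])
qed

text \<open>The difference is a coefficient of B^n (B^t - 1), and Frobenius puts B^t - 1 into
  \<open>val_ideal p (p ^ a)\<close>; \<open>d < p ^ a\<close> yields the extra 1.\<close>

lemma bernoulli_gf_power_shift: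
  assumes p: "prime p" and "p ^ a dvd t" "d < p ^ a"
  shows "val_ge p (1 - int d) (bernoulli_gf ^ (t + n) $ d - bernoulli_gf ^ n $ d)"
proof -
  obtain u where u: "t = p ^ a * u" using assms by auto
  have "bernoulli_gf ^ t - 1 \<in> val_ideal p (p ^ a)"
    using val_ideal_power_diff_one[OF p val_ideal_power_p_power[OF p bernoulli_gf_val_ideal(2)[OF p]]]
    by (simp add: u power_mult)
  moreover have "bernoulli_gf ^ n \<in> val_ideal p 0"
    using val_ideal_power[OF p bernoulli_gf_val_ideal(1)[OF p], of n] by simp
  ultimately have "bernoulli_gf ^ n * (bernoulli_gf ^ t - 1) \<in> val_ideal p (0 + p ^ a)"
    by (intro val_ideal_mult[OF p])
  from val_idealD[OF p this, of d] assms show ?thesis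
    by (simp add: power_add algebra_simps)
qed

text \<open>Since \<open>i < p ^ a\<close>, the valuation of \<open>i\<close> is below
  \<open>a\<close>, while a nonzero \<open>t\<close> has valuation at least \<open>a\<close>; so
  \<open>i\<close> dominates \<open>t + i\<close>.\<close>

lemma shift_same_val_unit:
  assumes p: "prime p" and "0 < i" "i < p ^ a" "p ^ a dvd t"
  shows "padic_val p (of_nat (t + i)) = padic_val p (of_nat i)"
    and "padic_cong p (unit_part p (of_nat (t + i))) (unit_part p (of_nat i))"
proof -
  have "p ^ multiplicity p i \<le> i" using assms by (intro dvd_imp_le multiplicity_dvd) auto
  hence "p ^ multiplicity p i < p ^ a" using assms by simp
  hence less: "multiplicity p i < a" using p_ge_2[OF p] by (auto dest: power_less_imp_less_exp)
  have "val_ge p ((int p - 1) * padic_val p (of_nat i) + 1) (of_nat (t + i) - of_nat i)"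
  proof (cases "t = 0")
    case True
    thus ?thesis by (simp add: val_ge_0[OF p])
  next
    case False
    have "a \<le> multiplicity p t"
      using False p p_ge_2[OF p] assms(4) by (intro multiplicity_geI) auto
    hence "int (multiplicity p i) + 1 \<le> int (multiplicity p t)" using less by simp
    hence "(int p - 1) * (int (multiplicity p i) + 1) \<le> (int p - 1) * int (multiplicity p t)"
      using p_ge_2[OF p] by (intro mult_left_mono) auto
    thus ?thesis using False assms p_ge_2[OF p]
      by (simp add: val_ge_def padic_val_of_nat algebra_simps)
  qed
  thus "padic_val p (of_nat (t + i)) = padic_val p (of_nat i)"
    "padic_cong p (unit_part p (of_nat (t + i))) (unit_part p (of_nat i))"
    using padic_val_eq_of_diff(2)[OF p] padic_cong_of_diff[OF p] assms(2) by simp_all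
qed

lemma val_fact_quotient:
  assumes p: "prime p" and "1 \<le> k" "k \<le> n"
  shows "(int p - 1) * padic_val p (\<Prod>i=k..<n. of_nat i) =
    int (n - k) + int (digit_sum p (k - 1)) - int (digit_sum p (n - 1))"
proof -
  have "(\<Prod>i=k..<n. of_nat i :: rat) \<noteq> 0" using assms(2) by simp
  hence "padic_val p (fact (n - 1)) = padic_val p (fact (k - 1)) + padic_val p (\<Prod>i=k..<n. of_nat i)"
    unfolding fact_eq_fact_mult_prod[OF assms(2,3)] by (intro padic_val_mult[OF p]) auto
  hence "(int p - 1) * padic_val p (\<Prod>i=k..<n. of_nat i) =
      (int p - 1) * padic_val p (fact (n - 1)) - (int p - 1) * padic_val p (fact (k - 1))"
    by (simp add: algebra_simps)
  thus ?thesis using assms by (simp add: padic_val_fact[OF p] of_nat_diff)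
qed

text \<open>By \<open>val_fact_quotient\<close> the product in
  \<open>stirling_signed_eq_prod\<close> contributes exactly the digit sums plus
  \<open>n - k\<close>, so the coefficient must have scaled valuation \<open>- (n - k)\<close>, the
  least possible. This criterion sees the shift only through the power of B, as \<open>n - k\<close>
  is unchanged.\<close>

lemma minimum_zero_case_iff:
  assumes p: "prime p" and "1 \<le> k" "k \<le> n"
  shows "minimum_zero_case p n k \<longleftrightarrow> bernoulli_gf ^ n $ (n - k) \<noteq> 0 \<and>
    (int p - 1) * padic_val p (bernoulli_gf ^ n $ (n - k)) = - int (n - k)"
proof -
  let ?s = "of_int (stirling_signed n k) :: rat" and ?b = "bernoulli_gf ^ n $ (n - k)"
  have P: "(\<Prod>i=k..<n. of_nat i :: rat) \<noteq> 0" using assms by auto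
  have s0: "stirling_signed n k \<noteq> 0 \<longleftrightarrow> ?b \<noteq> 0"
    using stirling_signed_eq_prod[OF assms(2,3)] P by (metis mult_eq_0_iff of_int_eq_0_iff)
  have "rat_of_int (padic_val p ?s) =
       (rat_of_nat (digit_sum p (k - 1)) - rat_of_nat (digit_sum p (n - 1))) / (rat_of_nat p - 1)
    \<longleftrightarrow> rat_of_int ((int p - 1) * padic_val p ?s) =
       rat_of_int (int (digit_sum p (k - 1)) - int (digit_sum p (n - 1)))"
    using p_ge_2[OF p] by (simp add: field_simps)
  also have "\<dots> \<longleftrightarrow> (int p - 1) * padic_val p ?s =
       int (digit_sum p (k - 1)) - int (digit_sum p (n - 1))"
    by (rule of_int_eq_iff)
  finally have 1: "minimum_zero_case p n k \<longleftrightarrow> ?b \<noteq> 0 \<and> (int p - 1) * padic_val p ?s =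
       int (digit_sum p (k - 1)) - int (digit_sum p (n - 1))"
    unfolding minimum_zero_case_def s0 by simp
  have 2: "(int p - 1) * padic_val p ?s = (int p - 1) * padic_val p (\<Prod>i=k..<n. of_nat i)
      + (int p - 1) * padic_val p ?b" if "?b \<noteq> 0"
    using stirling_signed_eq_prod[OF assms(2,3)] padic_val_mult[OF p P that]
    by (simp add: algebra_simps)
  show ?thesis unfolding 1 using 2 val_fact_quotient[OF assms] by auto
qed

theorem theorem3p3:
  fixes p n k t :: nat
  assumes "prime p"
    and "1 \<le> k" and "k \<le> n"
    and "minimum_zero_case p n k"
    and "t = 0 \<or> n < p ^ multiplicity p t"
  shows "minimum_zero_case p (t + n) (t + k)
    \<and> padic_val p (of_int (stirling_signed (t + n) (t + k)))
        = padic_val p (of_int (stirling_signed n k))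
    \<and> padic_cong p (unit_part p (of_int (stirling_signed (t + n) (t + k))))
                   (unit_part p (of_int (stirling_signed n k)))"
proof -
  note p = \<open>prime p\<close>
  \<comment> \<open>For \<open>t = 0\<close> every power of \<open>p\<close> divides
    \<open>t\<close>, and the exponent \<open>n\<close> is large enough; otherwise the multiplicity
    of \<open>p\<close> in \<open>t\<close> serves.\<close>
  obtain a where a: "p ^ a dvd t" "n < p ^ a"
  proof (cases "t = 0")
    case True
    have "n < p ^ n" using p_ge_2[OF p] by (intro power_gt_expt) simp
    with True that show ?thesis by auto
  qed (use assms(5) that multiplicity_dvd in blast)
  define b b' where "b = bernoulli_gf ^ n $ (n - k)" and "b' = bernoulli_gf ^ (t + n) $ (n - k)"
  define f f' where "f = (\<lambda>i. of_nat i :: rat)" and "f' = (\<lambda>i. of_nat (t + i) :: rat)"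
  define P P' where "P = prod f {k..<n}" and "P' = prod f' {k..<n}"
  have s: "of_int (stirling_signed n k) = P * b"
    using stirling_signed_eq_prod[OF assms(2,3)] by (simp add: P_def f_def b_def)
  have "(\<Prod>i=t + k..<t + n. of_nat i) = P'"
    unfolding P'_def f'_def
    using prod.shift_bounds_nat_ivl[of of_nat k t n] by (simp add: add.commute)
  hence s': "of_int (stirling_signed (t + n) (t + k)) = P' * b'"
    using stirling_signed_eq_prod[of "t + k" "t + n"] assms by (simp add: b'_def)
  have b: "b \<noteq> 0" "(int p - 1) * padic_val p b = - int (n - k)"
    using assms(4) minimum_zero_case_iff[OF assms(1-3)] by (auto simp: b_def)
  \<comment> \<open>As \<open>b\<close> attains the minimum, the required bound is
    \<open>1 - int (n - k)\<close>, exactly what \<open>bernoulli_gf_power_shift\<close>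
    provides.\<close>
  have "val_ge p ((int p - 1) * padic_val p b + 1) (b' - b)"
    using bernoulli_gf_power_shift[OF p a(1), of "n - k" n] a(2) b
    by (simp add: b_def b'_def)
  note diff = padic_val_eq_of_diff[OF p b(1) this] padic_cong_of_diff[OF p b(1) this]
  have f: "f i \<noteq> 0" "f' i \<noteq> 0" "padic_val p (f' i) = padic_val p (f i)"
    "padic_cong p (unit_part p (f' i)) (unit_part p (f i))" if "i \<in> {k..<n}" for i
    using shift_same_val_unit[OF p _ _ a(1), of i] that assms(2) a(2) by (auto simp: f_def f'_def)
  have P: "P \<noteq> 0" "P' \<noteq> 0" using f by (auto simp: P_def P'_def)
  have "padic_val p P' = (\<Sum>i\<in>{k..<n}. padic_val p (f' i))"
    unfolding P'_def by (rule padic_val_prod[OF p f(2)])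
  also have "\<dots> = (\<Sum>i\<in>{k..<n}. padic_val p (f i))"
    by (rule sum.cong[OF refl f(3)])
  also have "\<dots> = padic_val p P"
    unfolding P_def by (rule padic_val_prod[OF p f(1), symmetric])
  finally have vP: "padic_val p P' = padic_val p P" .
  have uP: "padic_cong p (unit_part p P') (unit_part p P)"
    unfolding P_def P'_def by (rule unit_part_prod_cong[OF p]) (use f in auto)
  have "minimum_zero_case p (t + n) (t + k)"
    using minimum_zero_case_iff[OF p, of "t + k" "t + n"] assms(2,3) diff b by (simp add: b'_def)
  moreover have "padic_val p (P' * b') = padic_val p (P * b)"
    using P b diff vP by (simp add: padic_val_mult[OF p])
  moreover have "padic_cong p (unit_part p (P' * b')) (unit_part p (P * b))"
    using P b diff uP
    by (simp add: unit_part_mult[OF p] padic_cong_mult[OF p] val_ge_unit_part[OF p])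
  ultimately show ?thesis by (simp add: s s')
qed

end
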